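(* Let $G$ be a primitive permutation group on a finite set $X$. Let $j\ge 1$, let $d_1,\dots,d_j\ge 2$ be integers, and put $d=-j+\sum_{i=1}^j d_i$. Let $l\ge l_d$, where $l_1=2$ and $l_m=l_{m-1}+m$ for $m\ge 2$. Then $G$ synchronizes every map $f:X\to X$ of kernel type $(l,d_1,d_2,\dots,d_j,1,\dots,1)$.
   Context: A permutation group $G$ on $X$ is primitive if it is transitive and preserves no equivalence relation on $X$ other than equality and the universal relation. A map $f$ has kernel type $(l,d_1,\dots,d_j,1,\dots,1)$ if its kernel classes (non-empty fibres) have sizes $l,d_1,\dots,d_j$, together with an arbitrary number of classes of size $1$. $G$ synchronizes $f$ if the transformation semigroup $\langle G,f\rangle$ contains a constant map. *)

theory Defs
  imports "HOL-Algebra.Group_Action" "HOL-Library.Multiset"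
begin

text \<open>
  Self-maps of \<open>X\<close> are elements of \<open>X \<rightarrow>\<^sub>E X\<close> (value \<open>undefined\<close> outside \<open>X\<close>), composed
  with \<open>compose X\<close>, in accordance with the symmetric group \<open>BijGroup X\<close> of \<open>HOL-Algebra\<close>.
\<close>

definition permutation_group_on :: "('a \<Rightarrow> 'a) set \<Rightarrow> 'a set \<Rightarrow> bool" where
  "permutation_group_on G X \<longleftrightarrow> subgroup G (BijGroup X)"

definition transitive_on :: "('a \<Rightarrow> 'a) set \<Rightarrow> 'a set \<Rightarrow> bool" where
  "transitive_on G X \<longleftrightarrow> transitive_action (BijGroup X\<lparr>carrier := G\<rparr>) X (\<lambda>g. g)"

definition preserves_relation :: "('a \<Rightarrow> 'a) set \<Rightarrow> ('a \<times> 'a) set \<Rightarrow> bool" where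
  "preserves_relation G r \<longleftrightarrow> (\<forall>g\<in>G. \<forall>(x, y)\<in>r. (g x, g y) \<in> r)"

definition primitive_on :: "('a \<Rightarrow> 'a) set \<Rightarrow> 'a set \<Rightarrow> bool" where
  "primitive_on G X \<longleftrightarrow>
     permutation_group_on G X \<and> transitive_on G X \<and>
     (\<forall>r. equiv X r \<and> preserves_relation G r \<longrightarrow> r = Id_on X \<or> r = X \<times> X)"

definition kernel_classes :: "'a set \<Rightarrow> ('a \<Rightarrow> 'a) \<Rightarrow> 'a set set" where
  "kernel_classes X f = (\<lambda>y. {x \<in> X. f x = y}) ` (f ` X)"

text \<open>
  \<open>has_kernel_type X f ds\<close>: the kernel type is \<open>(ds ! 0, ds ! 1, \<dots>, 1, \<dots>, 1)\<close>, i.e. the sizes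
  of the kernel classes, with multiplicity, are those in \<open>ds\<close> together with \<open>k\<close> further classes of size 1, for
  some \<open>k \<ge> 0\<close>. Only meaningful for finite \<open>X\<close>.
\<close>

definition has_kernel_type :: "'a set \<Rightarrow> ('a \<Rightarrow> 'a) \<Rightarrow> nat list \<Rightarrow> bool" where
  "has_kernel_type X f ds \<longleftrightarrow>
     (\<exists>k. image_mset card (mset_set (kernel_classes X f)) = mset ds + replicate_mset k 1)"

inductive_set generated_semigroup :: "'a set \<Rightarrow> ('a \<Rightarrow> 'a) set \<Rightarrow> ('a \<Rightarrow> 'a) set"
  for X :: "'a set" and S :: "('a \<Rightarrow> 'a) set" where
  base: "g \<in> S \<Longrightarrow> g \<in> generated_semigroup X S"
| comp: "\<lbrakk>g \<in> generated_semigroup X S; h \<in> generated_semigroup X S\<rbrakk>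
         \<Longrightarrow> compose X g h \<in> generated_semigroup X S"

definition synchronizes :: "'a set \<Rightarrow> ('a \<Rightarrow> 'a) set \<Rightarrow> ('a \<Rightarrow> 'a) \<Rightarrow> bool" where
  "synchronizes X G f \<longleftrightarrow> (\<exists>c\<in>X. (\<lambda>x\<in>X. c) \<in> generated_semigroup X (insert f G))"

text \<open>The sequence \<open>l\<^sub>m\<close> is indexed from 1; its value at 0 is a dummy.\<close>

fun l_seq :: "nat \<Rightarrow> nat" where
  "l_seq 0 = 0"
| "l_seq (Suc 0) = 2"
| "l_seq (Suc (Suc m)) = l_seq (Suc m) + Suc (Suc m)"

end

theory Submission
  imports Defs
begin

text \<open>
  Write \<open>S\<close> for the semigroup generated by \<open>G\<close> and \<open>f\<close>, and suppose that it contains no constant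
  map. Join two points of \<open>X\<close> by an edge when no element of \<open>S\<close> sends them to the same point. The
  elements of \<open>S\<close> are endomorphisms of this graph and \<open>G\<close> acts on it, so all vertices have the same
  valency \<open>k\<close>.

  Let \<open>r\<close> be the minimal rank of an element of \<open>S\<close>. The image of an element of rank \<open>r\<close> is a clique,
  so there are cliques of size \<open>r\<close>, and by transitivity every vertex lies on the same number
  \<open>e > 0\<close> of them. If two of them have the form \<open>insert a P\<close> and \<open>insert b P\<close>, then every map of
  rank \<open>r\<close> identifies \<open>a\<close> and \<open>b\<close>; as being identified by all maps of rank \<open>r\<close> is a \<open>G\<close>-invariant
  equivalence, and not the universal one because no map of rank \<open>r\<close> is constant, primitivity gives
  \<open>a = b\<close> (lemma \<open>r_cliques_exchange\<close>).

  The main inequality bounds the union \<open>N(A)\<close> of the neighbourhoods of the vertices of a nonempty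
  independent set \<open>A\<close> from below: \<open>|N(A)| \<ge> k + |A| - 1\<close>. Fix \<open>b \<in> A\<close>. An \<open>r\<close>-clique through
  some other \<open>a \<in> A\<close> is contained in \<open>N(A)\<close> except for \<open>a\<close>, and it must meet \<open>N(A) - N(b)\<close>,
  because otherwise \<open>a\<close> could be exchanged
  for \<open>b\<close>. Since an independent set meets a clique at most once, the \<open>(|A| - 1) e\<close> such cliques are
  distinct, while at most \<open>(|N(A)| - k) e\<close> cliques meet \<open>N(A) - N(b)\<close>
  (lemma \<open>independent_neighbourhood\<close>).

  Apply this to the kernel class \<open>K\<close> of size \<open>l\<close>. It is independent, and \<open>f\<close> maps \<open>N(K)\<close>, which
  avoids \<open>K\<close>, into the \<open>k\<close> neighbours of the point \<open>f(K)\<close>. The remaining kernel classes can account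
  for a loss of at most \<open>d\<close> points, so \<open>|N(K)| \<le> k + d\<close> and hence \<open>l \<le> d + 1\<close>. But
  \<open>l\<^sub>d \<ge> d + 2\<close> as soon as \<open>d \<ge> 2\<close>. This leaves \<open>d = 1\<close> and \<open>l = 2\<close>, say \<open>K = {a, b}\<close>:
  then all \<open>r\<close>-cliques through \<open>a\<close> pass through one and the same further vertex, and primitivity,
  applied to the equivalence of lying on the same \<open>r\<close>-cliques, forces \<open>a\<close> and \<open>b\<close> to be adjacent
  (lemma \<open>nonadjacent_pair_neighbourhood\<close>).
\<close>

section \<open>Loss of cardinality under a map of given kernel type\<close>

lemma finite_kernel_classes: "finite X \<Longrightarrow> finite (kernel_classes X f)"
  by (simp add: kernel_classes_def)

lemma sum_kernel_classes:
  assumes "has_kernel_type X f ds"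
  shows "(\<Sum>C\<in>kernel_classes X f. card C - 1) = (\<Sum>c\<leftarrow>ds. c - 1)"
proof -
  obtain k where k: "image_mset card (mset_set (kernel_classes X f)) = mset ds + replicate_mset k 1"
    using assms by (auto simp: has_kernel_type_def)
  have "(\<Sum>C\<in>kernel_classes X f. card C - 1)
      = sum_mset (image_mset (\<lambda>c. c - 1) (image_mset card (mset_set (kernel_classes X f))))"
    by (simp add: sum_unfold_sum_mset image_mset.compositionality comp_def)
  also have "\<dots> = (\<Sum>c\<leftarrow>ds. c - 1)"
    by (simp add: k flip: sum_mset_sum_list)
  finally show ?thesis .
qed

lemma kernel_class_of_card:
  assumes "finite X" "has_kernel_type X f ds" "c \<in> set ds"
  obtains C where "C \<in> kernel_classes X f" "card C = c"
proof -
  have "c \<in># image_mset card (mset_set (kernel_classes X f))"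
    using assms(2,3) by (auto simp: has_kernel_type_def simp del: set_image_mset)
  then show ?thesis
    using that finite_kernel_classes[OF assms(1)] by auto
qed

text \<open>
  Every fibre other than \<open>K\<close> meets \<open>N\<close> in at most one point more than its excess over a singleton;
  summing over the fibres that \<open>N\<close> meets gives the bound.
\<close>

lemma card_le_card_image_plus_excess:
  assumes fin: "finite X" and ktype: "has_kernel_type X f (l # ds)"
    and K: "K \<in> kernel_classes X f" "card K = l" and N: "N \<subseteq> X - K"
  shows "card N \<le> card (f ` N) + (\<Sum>c\<leftarrow>ds. c - 1)"
proof -
  define F where "F y = {x \<in> X. f x = y}" for y
  have KC: "kernel_classes X f = F ` f ` X"
    by (simp add: kernel_classes_def F_def)
  have finN: "finite N" using N fin by (meson finite_Diff finite_subset)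
  have inj: "inj_on F (f ` N)"
    using N by (force simp: inj_on_def F_def)
  have notK: "F ` f ` N \<subseteq> kernel_classes X f - {K}"
    using N unfolding KC by (auto simp: F_def)
  have "N \<subseteq> (\<Union>y\<in>f ` N. F y)"
    using N by (auto simp: F_def)
  then have "card N \<le> card (\<Union>y\<in>f ` N. F y)"
    by (rule card_mono[rotated]) (use fin finN in \<open>auto simp: F_def\<close>)
  also have "\<dots> \<le> (\<Sum>y\<in>f ` N. card (F y))"
    by (rule card_UN_le) (use finN in simp)
  also have "\<dots> \<le> (\<Sum>y\<in>f ` N. 1 + (card (F y) - 1))"
    by (rule sum_mono) simp
  also have "\<dots> = card (f ` N) + (\<Sum>C\<in>F ` f ` N. card C - 1)"
    by (simp only: sum.distrib sum.reindex[OF inj]) simp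
  also have "(\<Sum>C\<in>F ` f ` N. card C - 1) \<le> (\<Sum>C\<in>kernel_classes X f - {K}. card C - 1)"
    by (rule sum_mono2) (use notK finite_kernel_classes[OF fin] in auto)
  also have "\<dots> = (\<Sum>c\<leftarrow>ds. c - 1)"
    using sum_kernel_classes[OF ktype] sum.remove[OF finite_kernel_classes[OF fin] K(1), of "\<lambda>C. card C - 1"] K(2)
    by simp
  finally show ?thesis by simp
qed

section \<open>The graph of a map that is not synchronized\<close>

locale not_synchronized =
  fixes X :: "'a set" and G :: "('a \<Rightarrow> 'a) set" and f :: "'a \<Rightarrow> 'a"
  assumes finite_X: "finite X" and nonempty_X: "X \<noteq> {}"
    and primitive: "primitive_on G X"
    and f_maps: "f \<in> X \<rightarrow>\<^sub>E X"
    and not_sync: "\<not> synchronizes X G f"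
begin

definition S :: "('a \<Rightarrow> 'a) set"
  where "S = generated_semigroup X (insert f G)"

definition min_rank :: nat
  where "min_rank = Min ((\<lambda>h. card (h ` X)) ` S)"

definition adj :: "'a \<Rightarrow> 'a \<Rightarrow> bool"
  where "adj x y \<longleftrightarrow> x \<in> X \<and> y \<in> X \<and> (\<forall>h\<in>S. h x \<noteq> h y)"

definition nbrs :: "'a \<Rightarrow> 'a set"
  where "nbrs x = {y. adj x y}"

text \<open>
  These are the cliques through \<open>x\<close> of the largest size that occurs in the graph: a map of minimal
  rank is injective on every clique, and its image is a clique.
\<close>

definition r_cliques :: "'a \<Rightarrow> 'a set set"
  where "r_cliques x = {Q. x \<in> Q \<and> Q \<subseteq> X \<and> card Q = min_rank \<and> pairwise adj Q}"

lemma bij_G: "g \<in> G \<Longrightarrow> bij_betw g X X"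
  and extensional_G: "g \<in> G \<Longrightarrow> g \<in> extensional X"
  using primitive subgroup.subset[of G "BijGroup X"]
  by (auto simp: primitive_on_def permutation_group_on_def BijGroup_def Bij_def)

lemma G_maps: "g \<in> G \<Longrightarrow> g \<in> X \<rightarrow>\<^sub>E X"
  using bij_G[of g] extensional_G[of g] by (auto simp: bij_betw_def PiE_def)

lemma transitive: "x \<in> X \<Longrightarrow> y \<in> X \<Longrightarrow> \<exists>g\<in>G. g x = y"
  using primitive transitive_action.unique_orbit[of "BijGroup X\<lparr>carrier := G\<rparr>" X "\<lambda>g. g" x y]
  by (auto simp: primitive_on_def transitive_on_def)

lemma primitive_equiv:
  assumes "equiv X r" "\<And>g x y. g \<in> G \<Longrightarrow> (x, y) \<in> r \<Longrightarrow> (g x, g y) \<in> r"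
  shows "r = Id_on X \<or> r = X \<times> X"
  using primitive assms by (auto simp: primitive_on_def preserves_relation_def)

lemma f_in_S: "f \<in> S" and G_in_S: "g \<in> G \<Longrightarrow> g \<in> S"
  by (auto simp: S_def intro: generated_semigroup.base)

lemma compose_in_S: "g \<in> S \<Longrightarrow> h \<in> S \<Longrightarrow> compose X g h \<in> S"
  by (auto simp: S_def intro: generated_semigroup.comp)

lemma S_maps:
  assumes "h \<in> S"
  shows "h \<in> X \<rightarrow>\<^sub>E X"
  using assms unfolding S_def
proof (induction rule: generated_semigroup.induct)
  case (base g)
  then show ?case using f_maps G_maps by auto
next
  case (comp g h)
  then show ?case by (auto simp: compose_def)
qed

lemma finite_S: "finite S"
  by (rule finite_subset[of _ "X \<rightarrow>\<^sub>E X"]) (use S_maps finite_X in \<open>auto intro: finite_PiE\<close>)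

lemma min_rank_le: "h \<in> S \<Longrightarrow> min_rank \<le> card (h ` X)"
  using finite_S by (simp add: min_rank_def)

lemma min_rank_attained: obtains h where "h \<in> S" "card (h ` X) = min_rank"
proof -
  have "min_rank \<in> (\<lambda>h. card (h ` X)) ` S"
    unfolding min_rank_def using finite_S f_in_S by (intro Min_in) auto
  then show ?thesis using that by auto
qed

lemma adj_sym: "adj x y \<Longrightarrow> adj y x"
  unfolding adj_def by metis

lemma adj_irrefl: "\<not> adj x x"
  using f_in_S by (auto simp: adj_def)

lemma adj_S:
  assumes "s \<in> S" "adj x y"
  shows "adj (s x) (s y)"
  unfolding adj_def
proof (intro conjI ballI)
  show "s x \<in> X" "s y \<in> X" using S_maps[OF assms(1)] assms(2) by (auto simp: adj_def)
next
  fix h assume "h \<in> S"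
  then have "compose X h s \<in> S" using assms(1) compose_in_S by blast
  then show "h (s x) \<noteq> h (s y)"
    using assms(2) by (auto simp: adj_def compose_def)
qed

lemma nbrs_subset: "nbrs x \<subseteq> X"
  by (auto simp: nbrs_def adj_def)

lemma finite_nbrs: "finite (nbrs x)"
  using nbrs_subset finite_X finite_subset by blast

lemma finite_r_cliques: "finite (r_cliques x)"
  by (rule finite_subset[of _ "Pow X"]) (auto simp: r_cliques_def finite_X)

section \<open>Regularity\<close>

lemma card_nbrs_eq:
  assumes "x \<in> X" "y \<in> X"
  shows "card (nbrs x) = card (nbrs y)"
proof -
  have "card (nbrs u) \<le> card (nbrs v)" if uv: "u \<in> X" "v \<in> X" for u v
  proof -
    obtain g where g: "g \<in> G" "g u = v" using transitive uv by blast
    have "inj_on g (nbrs u)"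
      using bij_G[OF g(1)] nbrs_subset by (meson bij_betw_def inj_on_subset)
    moreover have "g ` nbrs u \<subseteq> nbrs v"
      using g adj_S[OF G_in_S[OF g(1)], of u] by (auto simp: nbrs_def)
    ultimately show ?thesis using card_inj_on_le finite_nbrs by blast
  qed
  then show ?thesis using assms by (simp add: le_antisym)
qed

lemma image_r_cliques_subset:
  assumes "g \<in> G" "x \<in> X"
  shows "(`) g ` r_cliques x \<subseteq> r_cliques (g x)"
proof (rule image_subsetI)
  fix Q assume Q: "Q \<in> r_cliques x"
  then have QX: "Q \<subseteq> X" by (simp add: r_cliques_def)
  have "inj_on g Q" using bij_G[OF assms(1)] QX by (meson bij_betw_def inj_on_subset)
  then have "card (g ` Q) = min_rank" using Q by (simp add: card_image r_cliques_def)
  moreover have "g ` Q \<subseteq> X" using G_maps[OF assms(1)] QX by auto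
  moreover have "pairwise adj (g ` Q)"
    using Q adj_S[OF G_in_S[OF assms(1)]] by (fastforce simp: pairwise_def r_cliques_def)
  ultimately show "g ` Q \<in> r_cliques (g x)" using Q by (simp add: r_cliques_def)
qed

lemma inj_on_image_r_cliques:
  assumes "g \<in> G"
  shows "inj_on ((`) g) (r_cliques x)"
  by (rule inj_on_subset[OF inj_on_image_Pow[of g X]])
    (use bij_G[OF assms] in \<open>auto simp: bij_betw_def r_cliques_def\<close>)

lemma card_r_cliques_eq:
  assumes "x \<in> X" "y \<in> X"
  shows "card (r_cliques x) = card (r_cliques y)"
proof -
  have "card (r_cliques u) \<le> card (r_cliques v)" if uv: "u \<in> X" "v \<in> X" for u v
  proof -
    obtain g where g: "g \<in> G" "g u = v" using transitive uv by blast
    show ?thesis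
      using card_inj_on_le[OF inj_on_image_r_cliques[OF g(1)] _ finite_r_cliques[of v], of u]
        image_r_cliques_subset[OF g(1) uv(1)] g(2) by simp
  qed
  then show ?thesis using assms by (simp add: le_antisym)
qed

lemma image_r_cliques:
  assumes "g \<in> G" "x \<in> X"
  shows "(`) g ` r_cliques x = r_cliques (g x)"
proof (rule card_subset_eq)
  have "g x \<in> X" using G_maps assms by blast
  then show "card ((`) g ` r_cliques x) = card (r_cliques (g x))"
    using card_r_cliques_eq[OF assms(2)] by (metis card_image inj_on_image_r_cliques[OF assms(1)])
qed (use image_r_cliques_subset assms finite_r_cliques in auto)

text \<open>
  The image of a map of minimal rank is an \<open>r\<close>-clique, since a map collapsing two of its points
  could be composed with it to lower the rank.
\<close>

lemma card_r_cliques_pos: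
  assumes "x \<in> X"
  shows "0 < card (r_cliques x)"
proof -
  obtain h where h: "h \<in> S" "card (h ` X) = min_rank" by (rule min_rank_attained)
  have hX: "h ` X \<subseteq> X" using S_maps[OF h(1)] by auto
  have "adj u v" if uv: "u \<in> h ` X" "v \<in> h ` X" "u \<noteq> v" for u v
  proof (rule ccontr)
    assume "\<not> adj u v"
    then obtain s where s: "s \<in> S" "s u = s v" using uv hX by (auto simp: adj_def)
    have "\<not> inj_on s (h ` X)" using uv s(2) by (auto simp: inj_on_def)
    then have "card (s ` h ` X) < card (h ` X)"
      using finite_X card_image_le[of "h ` X" s] inj_on_iff_eq_card[of "h ` X" s] by simp
    moreover have "compose X s h ` X = s ` h ` X" by (auto simp: compose_def image_image)
    ultimately show False
      using min_rank_le[OF compose_in_S[OF s(1) h(1)]] h(2) by simp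
  qed
  then have "pairwise adj (h ` X)" by (simp add: pairwise_def)
  then have "h ` X \<in> r_cliques (h x)"
    using h(2) hX assms by (simp add: r_cliques_def)
  then have "card (r_cliques (h x)) \<noteq> 0" using finite_r_cliques by auto
  then show ?thesis using card_r_cliques_eq[of "h x" x] hX assms by auto
qed

section \<open>Cliques through an independent set\<close>

lemma identified_by_min_rank_maps:
  assumes "a \<in> X" "b \<in> X"
    and "\<And>h. h \<in> S \<Longrightarrow> card (h ` X) = min_rank \<Longrightarrow> h a = h b"
  shows "a = b"
proof -
  define r where "r = {(x, y) \<in> X \<times> X. \<forall>h\<in>S. card (h ` X) = min_rank \<longrightarrow> h x = h y}"
  have "equiv X r"
    by (rule equivI) (auto simp: r_def refl_on_def sym_def trans_def)
  moreover have "(g x, g y) \<in> r" if g: "g \<in> G" and xy: "(x, y) \<in> r" for g x y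
  proof -
    have "h (g x) = h (g y)" if h: "h \<in> S" "card (h ` X) = min_rank" for h
    proof -
      have "compose X h g ` X = h ` g ` X" by (auto simp: compose_def image_image)
      also have "g ` X = X" using bij_G[OF g] by (simp add: bij_betw_def)
      finally have "card (compose X h g ` X) = min_rank" using h(2) by simp
      then show ?thesis
        using xy compose_in_S[OF h(1) G_in_S[OF g]] by (fastforce simp: r_def compose_def)
    qed
    then show ?thesis using xy G_maps[OF g] by (auto simp: r_def)
  qed
  ultimately have "r = Id_on X \<or> r = X \<times> X" by (rule primitive_equiv)
  moreover have "r \<noteq> X \<times> X"
  proof
    \<comment> \<open>a map of minimal rank would be constant\<close>
    assume r: "r = X \<times> X"
    obtain h where h: "h \<in> S" "card (h ` X) = min_rank" by (rule min_rank_attained)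
    have "h x = h a" if "x \<in> X" for x
      using r assms(1) h that by (auto simp: r_def)
    then have "h = (\<lambda>x\<in>X. h a)"
      using S_maps[OF h(1)] by (intro extensionalityI[of _ X]) (auto simp: PiE_def)
    moreover have "h a \<in> X" using S_maps[OF h(1)] assms(1) by auto
    ultimately have "synchronizes X G f"
      using h(1) unfolding synchronizes_def S_def by metis
    then show False using not_sync by blast
  qed
  moreover have "(a, b) \<in> r" using assms by (auto simp: r_def)
  ultimately show ?thesis by auto
qed

text \<open>
  A map of minimal rank sends every \<open>r\<close>-clique bijectively onto its image. It therefore sends both
  exchanged points to the only element of the image outside \<open>h ` P\<close>.
\<close>

lemma r_cliques_exchange:
  assumes "insert a P \<in> r_cliques a" "insert b P \<in> r_cliques b" "a \<notin> P" "b \<notin> P"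
  shows "a = b"
proof (rule identified_by_min_rank_maps)
  show "a \<in> X" "b \<in> X" using assms by (auto simp: r_cliques_def)
next
  fix h assume h: "h \<in> S" "card (h ` X) = min_rank"
  have onto: "inj_on h Q \<and> h ` Q = h ` X" if Q: "Q \<in> r_cliques x" for Q x
  proof -
    have "inj_on h Q"
      using Q h(1) by (auto simp: inj_on_def r_cliques_def pairwise_def adj_def)
    then show ?thesis
      using Q h(2) finite_X
      by (simp add: card_image card_subset_eq image_mono r_cliques_def)
  qed
  have "h a \<in> insert (h b) (h ` P)" "h a \<notin> h ` P"
    using onto[OF assms(1)] onto[OF assms(2)] assms(3)
    by (auto simp: inj_on_def)
  then show "h a = h b" by simp
qed

lemma r_clique_leaves_nbrs:
  assumes b: "b \<in> X" "b \<noteq> a" "\<not> adj a b" and Q: "Q \<in> r_cliques a"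
  shows "\<exists>u\<in>nbrs a - nbrs b. Q \<in> r_cliques u"
proof (rule ccontr)
  assume neg: "\<not> ?thesis"
  define P where "P = Q - {a}"
  have QP: "Q = insert a P" "a \<notin> P" using Q by (auto simp: P_def r_cliques_def)
  have PX: "P \<subseteq> X" "finite P" using Q finite_X by (auto simp: P_def r_cliques_def finite_subset)
  have adj_a: "adj a u" if "u \<in> P" for u
    using Q QP that by (auto simp: r_cliques_def pairwise_def)
  have adj_b: "adj b u" if "u \<in> P" for u
    using neg adj_a[OF that] Q QP that by (auto simp: nbrs_def r_cliques_def)
  have "b \<notin> P" using adj_b adj_irrefl by blast
  then have "card (insert b P) = card Q" using QP PX by simp
  moreover have "pairwise adj (insert b P)"
    using Q QP adj_b adj_sym by (auto simp: r_cliques_def pairwise_insert)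
  ultimately have "insert b P \<in> r_cliques b"
    using Q b(1) PX by (auto simp: r_cliques_def)
  then have "a = b" using r_cliques_exchange Q QP \<open>b \<notin> P\<close> by blast
  then show False using b(2) by simp
qed

text \<open>
  The families \<open>r_cliques a\<close> for \<open>a \<in> A - {b}\<close> are pairwise disjoint and are all covered by the
  families \<open>r_cliques u\<close> for \<open>u\<close> in the neighbourhood of \<open>A\<close> but not adjacent to \<open>b\<close>. All families
  have the same size.
\<close>

lemma independent_neighbourhood:
  assumes A: "A \<subseteq> X" "b \<in> A" and indep: "\<And>x y. x \<in> A \<Longrightarrow> y \<in> A \<Longrightarrow> \<not> adj x y"
  shows "card (nbrs b) + card A \<le> card (\<Union>(nbrs ` A)) + 1"
proof -
  define U where "U = \<Union>(nbrs ` A)"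
  define e where "e = card (r_cliques b)"
  have bX: "b \<in> X" using A by auto
  have e: "card (r_cliques x) = e" if "x \<in> X" for x
    unfolding e_def by (rule card_r_cliques_eq[OF that bX])
  have finA: "finite A" using A finite_X finite_subset by blast
  have finU: "finite U" using finA finite_nbrs by (simp add: U_def)
  have UX: "U \<subseteq> X" using nbrs_subset by (auto simp: U_def)
  have disj: "r_cliques x \<inter> r_cliques y = {}" if "x \<in> A" "y \<in> A" "x \<noteq> y" for x y
    using indep[OF that(1,2)] that(3) by (auto simp: r_cliques_def pairwise_def)
  have sum_e: "(\<Sum>x\<in>B. card (r_cliques x)) = card B * e" if "B \<subseteq> X" for B
    using sum.cong[OF refl e, of B] that by (simp add: subset_iff)
  have "(card A - 1) * e = (\<Sum>a\<in>A - {b}. card (r_cliques a))"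
    using A sum_e[of "A - {b}"] by (simp add: subset_iff)
  also have "\<dots> = card (\<Union>a\<in>A - {b}. r_cliques a)"
    using finA finite_r_cliques disj by (intro card_UN_disjoint[symmetric]) auto
  also have "\<dots> \<le> card (\<Union>u\<in>U - nbrs b. r_cliques u)"
  proof (rule card_mono)
    show "(\<Union>a\<in>A - {b}. r_cliques a) \<subseteq> (\<Union>u\<in>U - nbrs b. r_cliques u)"
    proof
      fix Q assume "Q \<in> (\<Union>a\<in>A - {b}. r_cliques a)"
      then obtain a where a: "a \<in> A" "b \<noteq> a" "Q \<in> r_cliques a" by auto
      then obtain u where "u \<in> nbrs a - nbrs b" "Q \<in> r_cliques u"
        using r_clique_leaves_nbrs[OF bX] indep A(2) by meson
      then show "Q \<in> (\<Union>u\<in>U - nbrs b. r_cliques u)"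
        using a(1) by (auto simp: U_def)
    qed
  qed (use finU finite_r_cliques in auto)
  also have "\<dots> \<le> (\<Sum>u\<in>U - nbrs b. card (r_cliques u))"
    using finU by (intro card_UN_le) simp
  also have "\<dots> = card (U - nbrs b) * e"
    using UX sum_e[of "U - nbrs b"] by blast
  finally have "card A - 1 \<le> card (U - nbrs b)"
    using card_r_cliques_pos[OF bX] by (simp add: e_def)
  moreover have "card (U - nbrs b) = card U - card (nbrs b)" "card (nbrs b) \<le> card U"
    using A(2) finU finite_nbrs by (auto simp: U_def intro!: card_Diff_subset card_mono)
  moreover have "0 < card A" using A(2) finA card_gt_0_iff by blast
  ultimately show ?thesis unfolding U_def by linarith
qed

text \<open>
  For two nonadjacent vertices the previous inequality can be improved by one. If \<open>nbrs a\<close> had a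
  single vertex \<open>u\<close> outside \<open>nbrs b\<close>, then every \<open>r\<close>-clique through \<open>a\<close> would contain \<open>u\<close>, so \<open>a\<close>
  and \<open>u\<close> would lie on the same \<open>r\<close>-cliques. By primitivity this would hold for all pairs of
  vertices, in particular for \<open>a\<close> and \<open>b\<close>, which lie on no common clique.
\<close>

lemma nonadjacent_pair_neighbourhood:
  assumes ab: "a \<in> X" "b \<in> X" "a \<noteq> b" "\<not> adj a b"
  shows "card (nbrs b) + 2 \<le> card (nbrs a \<union> nbrs b)"
proof (rule ccontr)
  assume neg: "\<not> ?thesis"
  have "card (nbrs a \<union> nbrs b) = card (nbrs a - nbrs b) + card (nbrs b)"
    by (metis Un_Diff_cancel2 card_Un_disjoint Diff_disjoint finite_Diff finite_nbrs inf_commute)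
  then have le1: "card (nbrs a - nbrs b) \<le> 1" using neg by simp
  obtain Q where "Q \<in> r_cliques a" using card_r_cliques_pos[OF ab(1)] by fastforce
  then obtain u where u: "u \<in> nbrs a - nbrs b"
    using r_clique_leaves_nbrs[of b a Q] ab by blast
  have single: "nbrs a - nbrs b = {u}"
    using le1 u finite_nbrs
    by (metis card_le_Suc0_iff_eq One_nat_def finite_Diff is_singletonI' is_singleton_the_elem
        empty_iff singletonD)
  have uX: "u \<in> X" "u \<noteq> a" using u nbrs_subset adj_irrefl by (auto simp: nbrs_def)
  have "r_cliques a \<subseteq> r_cliques u"
    using r_clique_leaves_nbrs[of b a] ab single by auto
  then have au: "r_cliques a = r_cliques u"
    using card_subset_eq finite_r_cliques card_r_cliques_eq ab(1) uX(1) by metis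
  define r where "r = {(x, y) \<in> X \<times> X. r_cliques x = r_cliques y}"
  have "equiv X r"
    by (rule equivI) (auto simp: r_def refl_on_def sym_def trans_def)
  moreover have "(g x, g y) \<in> r" if "g \<in> G" "(x, y) \<in> r" for g x y
    using that image_r_cliques[of g x] image_r_cliques[of g y] G_maps[of g] by (auto simp: r_def)
  ultimately have "r = Id_on X \<or> r = X \<times> X" by (rule primitive_equiv)
  moreover have "(a, u) \<in> r" using au ab(1) uX by (simp add: r_def)
  ultimately have "r = X \<times> X" using uX(2) by auto
  then have "r_cliques a = r_cliques b" using ab by (auto simp: r_def)
  then have "Q \<in> r_cliques a \<inter> r_cliques b" using \<open>Q \<in> r_cliques a\<close> by simp
  then show False using ab by (auto simp: r_cliques_def pairwise_def)
qed

section \<open>The neighbourhood of a kernel class\<close>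

text \<open>
  The lower bounds for the neighbourhood of the class of size \<open>l\<close> meet the upper bound that comes
  from \<open>f\<close> mapping it into the neighbourhood of a single vertex.
\<close>

lemma kernel_type_bound:
  assumes ktype: "has_kernel_type X f (l # ds)" and l: "2 \<le> l"
  shows "l \<le> (\<Sum>c\<leftarrow>ds. c - 1) + 1" "(\<Sum>c\<leftarrow>ds. c - 1) \<noteq> 1"
proof -
  define d where "d = (\<Sum>c\<leftarrow>ds. c - 1)"
  obtain K where K: "K \<in> kernel_classes X f" "card K = l"
    using kernel_class_of_card[OF finite_X ktype, of l] by auto
  then obtain v where Kv: "K = {x \<in> X. f x = v}" "v \<in> f ` X"
    by (auto simp: kernel_classes_def)
  have KX: "K \<subseteq> X" and vX: "v \<in> X" using Kv f_maps by auto
  have indep: "\<not> adj x y" if "x \<in> K" "y \<in> K" for x y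
    using that f_in_S by (fastforce simp: Kv adj_def)
  define N where "N = \<Union>(nbrs ` K)"
  have "N \<subseteq> X - K" using nbrs_subset indep by (auto simp: N_def nbrs_def)
  then have "card N \<le> card (f ` N) + d"
    unfolding d_def by (rule card_le_card_image_plus_excess[OF finite_X ktype K])
  also have "card (f ` N) \<le> card (nbrs v)"
  proof (rule card_mono[OF finite_nbrs])
    show "f ` N \<subseteq> nbrs v"
      using adj_S[OF f_in_S] by (auto simp: N_def nbrs_def Kv)
  qed
  finally have upper: "card N \<le> card (nbrs v) + d" by simp
  obtain a b where ab: "a \<in> K" "b \<in> K" "a \<noteq> b"
    using K(2) l by (metis card_2_iff' obtain_subset_with_card_n subset_iff)
  have val: "card (nbrs b) = card (nbrs v)" using card_nbrs_eq ab(2) KX vX by blast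
  have "card (nbrs b) + l \<le> card N + 1"
    using independent_neighbourhood[OF KX ab(2) indep] K(2) by (simp add: N_def)
  then show l_le: "l \<le> (\<Sum>c\<leftarrow>ds. c - 1) + 1" using upper val by (simp add: d_def)
  have "card (nbrs a \<union> nbrs b) \<le> card N"
    using ab finite_nbrs KX finite_X
    by (intro card_mono) (auto simp: N_def intro: finite_subset)
  moreover have "card (nbrs b) + 2 \<le> card (nbrs a \<union> nbrs b)"
    using nonadjacent_pair_neighbourhood ab KX indep by blast
  ultimately show "(\<Sum>c\<leftarrow>ds. c - 1) \<noteq> 1"
    using upper val unfolding d_def by linarith
qed

end

section \<open>The synchronization theorem\<close>

lemma l_seq_ge: "2 \<le> d \<Longrightarrow> d + 2 \<le> l_seq d"
  by (induction d rule: l_seq.induct) (auto simp: le_Suc_eq numeral_2_eq_2)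

theorem theorem5p3:
  fixes X :: "'a set" and G :: "('a \<Rightarrow> 'a) set" and f :: "'a \<Rightarrow> 'a"
    and j d l :: nat and ds :: "nat list"
  assumes "finite X"
    and "primitive_on G X"
    and "j \<ge> 1"
    and "length ds = j"
    and "\<forall>i<j. ds ! i \<ge> 2"
    and "int d = - int j + (\<Sum>i<j. int (ds ! i))"
    and "l \<ge> l_seq d"
    and "f \<in> X \<rightarrow>\<^sub>E X"
    and "has_kernel_type X f (l # ds)"
  shows "synchronizes X G f"
proof (rule ccontr)
  assume not_sync: "\<not> synchronizes X G f"
  have "X \<noteq> {}"
    using kernel_class_of_card[OF assms(1,9), of l] by (auto simp: kernel_classes_def)
  then interpret not_synchronized X G f
    using assms not_sync by unfold_locales auto
  have "int (\<Sum>c\<leftarrow>ds. c - 1) = (\<Sum>i<j. int (ds ! i - 1))"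
    using assms(4) by (simp add: sum_list_sum_nth atLeast0LessThan)
  also have "\<dots> = (\<Sum>i<j. int (ds ! i) - 1)"
    using assms(5) by (intro sum.cong) (auto simp: of_nat_diff)
  also have "\<dots> = int d" using assms(6) by (simp add: sum_subtractf)
  finally have d: "(\<Sum>c\<leftarrow>ds. c - 1) = d" by simp
  have "int j = (\<Sum>i<j. 1)" by simp
  also have "\<dots> \<le> (\<Sum>i<j. int (ds ! i) - 1)" using assms(5) by (intro sum_mono) force
  also have "\<dots> = int d" by fact
  finally have "1 \<le> d" using assms(3) by simp
  show False
  proof (cases "d = 1")
    case True
    then show False using kernel_type_bound(2)[OF assms(9)] assms(7) d by simp
  next
    case False
    then have "d + 2 \<le> l" using l_seq_ge[of d] \<open>1 \<le> d\<close> assms(7) by simp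
    then show False using kernel_type_bound(1)[OF assms(9)] d by simp
  qed
qed

end
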